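(* Let $M$ be a loopless matroid on a finite ground set $E$ with rank function $\mathrm{rk}_M$ and closure operator $\mathrm{cl}_M$. Then the topological zeta function $Z^{\mathrm{top}}_M(s)\in\mathbb{Q}(s)$ has the expansion (as a power series at $s=0$) $$Z^{\mathrm{top}}_M(s)=\sum_{m\geq 0}(-1)^m\Bigg(\sum_{\mathbf e\in E^m}\ \prod_{j=1}^m\frac{1}{\mathrm{rk}_M(\{e_1,\ldots,e_j\})}\Bigg)s^m,$$ and its Möbius transform $Y^{\mathrm{top}}_M(s)\in\mathbb{Q}(s)$ has the expansion $$Y^{\mathrm{top}}_M(s)=\sum_{m\geq 0}(-1)^m\Bigg(\sum_{\substack{\mathbf e\in E^m\\ \mathrm{cl}_M(\{e_1,\ldots,e_m\})=E}}\ \prod_{j=1}^m\frac{1}{\mathrm{rk}_M(\{e_1,\ldots,e_j\})}\Bigg)s^m,$$ where $e_i$ denotes the $i$-th entry of the word $\mathbf e=(e_1,\ldots,e_m)\in E^m$.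
   Context: For a loopless matroid $M$ on $E$, $\mathcal{L}(M)$ is its lattice of flats (with bottom $\varnothing$ and top $E$), $\mu_{F,G}$ is the Möbius function of $\mathcal{L}(M)$, and for a flat $F$, $M|_F$ and $M/F$ denote restriction to and contraction by $F$ (both are loopless). The characteristic polynomial is $\chi_M(x)=\sum_{F\in\mathcal{L}(M)}\mu_{\varnothing,F}\,x^{\mathrm{rk}(M)-\mathrm{rk}_M(F)}$, and for $\mathrm{rk}(M)>0$ the reduced characteristic polynomial is $\overline{\chi}_M(x)=\chi_M(x)/(x-1)$. The topological zeta function $Z^{\mathrm{top}}_M(s)\in\mathbb{Q}(s)$ and its Möbius transform $Y^{\mathrm{top}}_M(s)\in\mathbb{Q}(s)$ are defined for all loopless matroids recursively as follows. If $\mathrm{rk}(M)=0$, then $Z^{\mathrm{top}}_M(s)=Y^{\mathrm{top}}_M(s)=1$. If $\mathrm{rk}(M)=r>0$ and $|E|=n$, then $$Z^{\mathrm{top}}_M(s)=\frac{1}{ns+r}\sum_{F\in\mathcal{L}(M),\ F\neq E}Z^{\mathrm{top}}_{M|_F}(s)\,\overline{\chi}_{M/F}(1),\qquad Y^{\mathrm{top}}_M(s)=\sum_{F\in\mathcal{L}(M)}Z^{\mathrm{top}}_{M|_F}(s)\,\mu_{F,E}.$$ These rational functions have no pole at $s=0$, so they have power series expansions at $s=0$. The set $E^0$ consists of the single empty word, and the empty product is $1$; the closure of the empty set is $\varnothing$. *)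

theory Defs
  imports "HOL-Computational_Algebra.Computational_Algebra"
begin

section \<open>Matroids on a finite ground set\<close>

definition is_matroid :: "'a set \<Rightarrow> 'a set set \<Rightarrow> bool" where
  "is_matroid E \<I> \<longleftrightarrow>
     finite E \<and>
     (\<forall>I\<in>\<I>. I \<subseteq> E) \<and>
     {} \<in> \<I> \<and>
     (\<forall>I\<in>\<I>. \<forall>J. J \<subseteq> I \<longrightarrow> J \<in> \<I>) \<and>
     (\<forall>I\<in>\<I>. \<forall>J\<in>\<I>. card I < card J \<longrightarrow> (\<exists>x\<in>J - I. insert x I \<in> \<I>))"

lemma is_matroidD:
  assumes "is_matroid E \<I>"
  shows "finite E"
    and "I \<in> \<I> \<Longrightarrow> I \<subseteq> E"
    and "{} \<in> \<I>"
    and "I \<in> \<I> \<Longrightarrow> J \<subseteq> I \<Longrightarrow> J \<in> \<I>"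
    and "I \<in> \<I> \<Longrightarrow> J \<in> \<I> \<Longrightarrow> card I < card J \<Longrightarrow> \<exists>x\<in>J - I. insert x I \<in> \<I>"
  using assms unfolding is_matroid_def by blast+

typedef 'a matroid = "{(E :: 'a set, \<I> :: 'a set set). is_matroid E \<I>}"
  by (rule exI[of _ "({}, {{}})"]) (auto simp: is_matroid_def)

setup_lifting type_definition_matroid

lift_definition ground :: "'a matroid \<Rightarrow> 'a set" is fst .

lift_definition indep_sets :: "'a matroid \<Rightarrow> 'a set set" is snd .

lemma finite_ground [simp]: "finite (ground M)"
  by transfer (auto simp: is_matroid_def)

lemma is_matroid_restriction:
  assumes M: "is_matroid E \<I>"
  shows "is_matroid (E \<inter> F) {I \<in> \<I>. I \<subseteq> F}"
    (is "is_matroid _ ?\<J>")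
  unfolding is_matroid_def
proof (intro conjI ballI allI impI)
  show "\<exists>x\<in>J - I. insert x I \<in> ?\<J>"
    if I: "I \<in> ?\<J>" and J: "J \<in> ?\<J>" and less: "card I < card J" for I J
  proof -
    obtain x where "x \<in> J - I" "insert x I \<in> \<I>"
      using is_matroidD(5)[OF M _ _ less] I J by auto
    then show ?thesis using I J by auto
  qed
qed (use is_matroidD(1-4)[OF M] in auto)

lift_definition restriction :: "'a matroid \<Rightarrow> 'a set \<Rightarrow> 'a matroid"
  is "\<lambda>(E, \<I>) F. (E \<inter> F, {I \<in> \<I>. I \<subseteq> F})"
  using is_matroid_restriction by auto

definition bases_of :: "'a set set \<Rightarrow> 'a set \<Rightarrow> 'a set set" where
  "bases_of \<I> F = {B \<in> \<I>. B \<subseteq> F \<and> (\<forall>I\<in>\<I>. B \<subseteq> I \<and> I \<subseteq> F \<longrightarrow> I = B)}"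

lemma ex_bases_of:
  assumes "is_matroid E \<I>"
  shows "bases_of \<I> F \<noteq> {}"
proof -
  let ?A = "{I \<in> \<I>. I \<subseteq> F}"
  have "finite ?A"
    by (rule finite_subset[of _ "Pow E"]) (use is_matroidD(1,2)[OF assms] in auto)
  moreover have "{} \<in> ?A"
    using is_matroidD(3)[OF assms] by simp
  ultimately obtain B where "B \<in> ?A" "\<forall>I\<in>?A. B \<subseteq> I \<longrightarrow> B = I"
    using finite_has_maximal[of ?A] by blast
  then show ?thesis
    by (auto simp: bases_of_def)
qed

lemma card_bases_of_le:
  assumes "is_matroid E \<I>" "B \<in> bases_of \<I> F" "I \<in> \<I>" "I \<subseteq> F"
  shows "card I \<le> card B"
proof (rule ccontr)
  assume "\<not> card I \<le> card B"
  then obtain x where "x \<in> I - B" "insert x B \<in> \<I>"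
    using is_matroidD(5)[OF assms(1), of B I] assms(2,3) by (auto simp: bases_of_def)
  with assms(2,4) show False
    unfolding bases_of_def by blast
qed

lemma is_matroid_contraction:
  assumes M: "is_matroid E \<I>"
  shows "is_matroid (E - F) {I. I \<inter> F = {} \<and> (\<exists>B\<in>bases_of \<I> F. I \<union> B \<in> \<I>)}"
    (is "is_matroid _ ?\<J>")
  unfolding is_matroid_def
proof (intro conjI ballI allI impI)
  show "finite (E - F)" using is_matroidD(1)[OF M] by simp
  show "I \<subseteq> E - F" if "I \<in> ?\<J>" for I
    using that is_matroidD(2)[OF M] by blast
  show "{} \<in> ?\<J>"
    using ex_bases_of[OF M, of F] by (auto simp: bases_of_def)
  show "J \<in> ?\<J>" if I: "I \<in> ?\<J>" and J: "J \<subseteq> I" for I J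
  proof -
    from I obtain B where B: "B \<in> bases_of \<I> F" "I \<union> B \<in> \<I>" by blast
    have "J \<union> B \<in> \<I>" by (rule is_matroidD(4)[OF M B(2)]) (use J in blast)
    with B(1) I J show ?thesis by blast
  qed
  show "\<exists>x\<in>J - I. insert x I \<in> ?\<J>"
    if I: "I \<in> ?\<J>" and J: "J \<in> ?\<J>" and less: "card I < card J" for I J
  proof -
    from I obtain B where B: "B \<in> bases_of \<I> F" "I \<union> B \<in> \<I>" by blast
    from J obtain C where C: "C \<in> bases_of \<I> F" "J \<union> C \<in> \<I>" by blast
    have BF: "B \<in> \<I>" "B \<subseteq> F" and CF: "C \<in> \<I>" "C \<subseteq> F"
      using B(1) C(1) by (auto simp: bases_of_def)
    have "finite (I \<union> B)" "finite (J \<union> C)"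
      using is_matroidD(2)[OF M B(2)] is_matroidD(2)[OF M C(2)] is_matroidD(1)[OF M]
      by (auto intro: finite_subset)
    then have fin: "finite I" "finite B" "finite J" "finite C" by auto
    have "card (I \<union> B) = card I + card B"
      by (rule card_Un_disjoint) (use fin I BF in auto)
    moreover have "card (J \<union> C) = card J + card C"
      by (rule card_Un_disjoint) (use fin J CF in auto)
    moreover have "card B \<le> card C"
      by (rule card_bases_of_le[OF M C(1) BF])
    ultimately have "card (I \<union> B) < card (J \<union> C)" using less by simp
    then obtain x where x: "x \<in> (J \<union> C) - (I \<union> B)" "insert x (I \<union> B) \<in> \<I>"
      using is_matroidD(5)[OF M B(2) C(2)] by blast
    have "x \<notin> F"
    proof
      assume "x \<in> F"
      moreover have "insert x B \<in> \<I>"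
        by (rule is_matroidD(4)[OF M x(2)]) blast
      ultimately have "insert x B = B"
        using B(1) BF(2) unfolding bases_of_def by blast
      with x(1) show False by blast
    qed
    with CF x(1) have "x \<in> J - I" by blast
    moreover have "insert x I \<in> ?\<J>"
      using I B(1) x(2) \<open>x \<notin> F\<close> by auto
    ultimately show ?thesis by blast
  qed
qed

text \<open>
  Independent sets of the contraction by F: the sets disjoint from F that stay independent after
  adding a basis of F (the choice of the basis does not matter).
\<close>

lift_definition contraction :: "'a matroid \<Rightarrow> 'a set \<Rightarrow> 'a matroid"
  is "\<lambda>(E, \<I>) F. (E - F, {I. I \<inter> F = {} \<and> (\<exists>B\<in>bases_of \<I> F. I \<union> B \<in> \<I>)})"
  using is_matroid_contraction by auto

definition rk :: "'a matroid \<Rightarrow> 'a set \<Rightarrow> nat" where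
  "rk M X = Max (card ` {I \<in> indep_sets M. I \<subseteq> X})"

definition cl :: "'a matroid \<Rightarrow> 'a set \<Rightarrow> 'a set" where
  "cl M X = {e \<in> ground M. rk M (insert e X) = rk M X}"

definition flats :: "'a matroid \<Rightarrow> 'a set set" where
  "flats M = {F. F \<subseteq> ground M \<and> cl M F = F}"

definition loopless :: "'a matroid \<Rightarrow> bool" where
  "loopless M \<longleftrightarrow> (\<forall>e\<in>ground M. {e} \<in> indep_sets M)"

lemma flats_subset: "F \<in> flats M \<Longrightarrow> F \<subseteq> ground M"
  by (simp add: flats_def)

lemma flats_finite: "F \<in> flats M \<Longrightarrow> finite F"
  using finite_subset[OF flats_subset finite_ground] .

lemma ground_restriction: "ground (restriction M F) = ground M \<inter> F"
  by transfer auto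


section \<open>Characteristic polynomials\<close>

text \<open>The Moebius function of the lattice of flats, extended by 0 to all other pairs of sets.\<close>

function moebius :: "'a matroid \<Rightarrow> 'a set \<Rightarrow> 'a set \<Rightarrow> int" where
  "moebius M F G =
     (if F \<in> flats M \<and> G \<in> flats M \<and> F \<subseteq> G
      then if F = G then 1
           else - (\<Sum>H\<in>{H \<in> flats M. F \<subseteq> H \<and> H \<subset> G}. moebius M F H)
      else 0)"
  by auto
termination
  by (relation "measure (\<lambda>(M, F, G). card G)")
     (auto intro!: psubset_card_mono flats_finite)

declare moebius.simps [simp del]

definition char_poly :: "'a matroid \<Rightarrow> int poly" where
  "char_poly M =
     (\<Sum>F\<in>flats M. monom (moebius M {} F) (rk M (ground M) - rk M F))"

text \<open>For positive rank, 1 is a root of the characteristic polynomial, so the division is exact.\<close>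

definition red_char_poly :: "'a matroid \<Rightarrow> int poly" where
  "red_char_poly M = char_poly M div [:-1, 1:]"


section \<open>Topological zeta functions\<close>

function Z_top :: "'a matroid \<Rightarrow> rat poly fract" where
  "Z_top M =
     (if rk M (ground M) = 0 then 1
      else 1 / to_fract [:of_nat (rk M (ground M)), of_nat (card (ground M)):] *
           (\<Sum>F\<in>flats M - {ground M}.
              Z_top (restriction M F) * of_int (poly (red_char_poly (contraction M F)) 1)))"
  by auto
termination
  by (relation "measure (\<lambda>M. card (ground M))")
     (auto simp: ground_restriction intro!: psubset_card_mono dest: flats_subset)

declare Z_top.simps [simp del]

definition Y_top :: "'a matroid \<Rightarrow> rat poly fract" where
  "Y_top M =
     (if rk M (ground M) = 0 then 1
      else \<Sum>F\<in>flats M. Z_top (restriction M F) * of_int (moebius M F (ground M)))"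


section \<open>Power series expansions\<close>

text \<open>
  The expansion at 0 of a rational function is its image under the canonical embedding of the
  field of rational functions into the field of formal Laurent series. It is a power series
  (an element of the image of \<^const>\<open>fps_to_fls\<close>) iff the function has no pole at 0.
\<close>

definition fls_of_fract :: "'a :: field poly fract \<Rightarrow> 'a fls" where
  "fls_of_fract r =
     (THE f. \<exists>p q. q \<noteq> 0 \<and> r = Fract p q \<and>
        f = fps_to_fls (fps_of_poly p) / fps_to_fls (fps_of_poly q))"

lemma fls_of_fract_Fract:
  fixes p q :: "'a :: field poly"
  assumes "q \<noteq> 0"
  shows "fls_of_fract (Fract p q) = fps_to_fls (fps_of_poly p) / fps_to_fls (fps_of_poly q)"
  unfolding fls_of_fract_def
proof (rule the_equality)
  fix f :: "'a fls"
  assume "\<exists>p' q'. q' \<noteq> 0 \<and> Fract p q = Fract p' q' \<and>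
            f = fps_to_fls (fps_of_poly p') / fps_to_fls (fps_of_poly q')"
  then obtain p' q' where *: "q' \<noteq> 0" "p * q' = p' * q"
    "f = fps_to_fls (fps_of_poly p') / fps_to_fls (fps_of_poly q')"
    using assms by (auto simp: eq_fract)
  have "fps_to_fls (fps_of_poly p) * fps_to_fls (fps_of_poly q') =
        fps_to_fls (fps_of_poly p') * fps_to_fls (fps_of_poly q)"
    using *(2) by (simp flip: fls_times_fps_to_fls fps_of_poly_mult)
  moreover have "fps_to_fls (fps_of_poly r) \<noteq> 0" if "r \<noteq> 0" for r :: "'a poly"
    using that fps_of_poly_eq_iff[of r 0] by simp
  ultimately show "f = fps_to_fls (fps_of_poly p) / fps_to_fls (fps_of_poly q)"
    using *(1,3) assms by (simp add: frac_eq_eq)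
qed (use assms in blast)

definition words :: "'a set \<Rightarrow> nat \<Rightarrow> 'a list set" where
  "words E m = {es. length es = m \<and> set es \<subseteq> E}"

end

theory Submission
  imports Defs
begin

text \<open>
  The value at 1 of the reduced characteristic polynomial of M/F is the derivative of the
  characteristic polynomial there, i.e. the sum of \<mu>(F, G) (r - rk(G)) over the flats G containing F.
  Hence, by Moebius inversion, these values add up to r - rk(e) over the proper flats F containing
  a word e. So the coefficient of (-s)^m on the right of the recursion for Z is the sum of
  w(e) (r - rk(e)) over words e of length m, where w(e) is the product of the 1/rk of the nonempty
  prefixes. The factor rk(e) cancels the last factor of w(e), which leaves n times the sum for
  length m - 1, in accordance with the factor ns + r on the left. For Y, the sum of \<mu>(F, E) over the
  flats F containing e is 1 if cl(e) = E and 0 otherwise.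
\<close>

section \<open>Rank, closure and flats\<close>

lemma is_matroid_indep_sets: "is_matroid (ground M) (indep_sets M)"
  by transfer auto

lemmas matroidD = is_matroidD[OF is_matroid_indep_sets]

lemma finite_indep_subsets: "finite {I \<in> indep_sets M. I \<subseteq> X}"
  by (rule finite_subset[of _ "Pow (ground M)"]) (use matroidD(2) in auto)

lemma indep_finite: "I \<in> indep_sets M \<Longrightarrow> finite I"
  using matroidD(2) finite_ground finite_subset by metis

lemma card_le_rk: "I \<in> indep_sets M \<Longrightarrow> I \<subseteq> X \<Longrightarrow> card I \<le> rk M X"
  unfolding rk_def by (rule Max_ge) (use finite_indep_subsets in auto)

lemma rk_attained:
  obtains I where "I \<in> indep_sets M" "I \<subseteq> X" "card I = rk M X"
proof -
  have "rk M X \<in> card ` {I \<in> indep_sets M. I \<subseteq> X}"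
    unfolding rk_def
    by (rule Max_in) (use finite_indep_subsets matroidD(3) in auto)
  then show ?thesis using that by auto
qed

lemma rk_mono: "X \<subseteq> Y \<Longrightarrow> rk M X \<le> rk M Y"
  by (metis rk_attained card_le_rk subset_trans)

lemma rk_empty [simp]: "rk M {} = 0"
  by (metis rk_attained card.empty subset_empty)

lemma rk_pos:
  assumes "loopless M" "X \<subseteq> ground M" "X \<noteq> {}"
  shows "rk M X > 0"
proof -
  obtain e where "e \<in> X" using assms by blast
  then have "card {e} \<le> rk M X"
    using assms by (intro card_le_rk) (auto simp: loopless_def)
  then show ?thesis by simp
qed

lemma rk_ground_eq_0_iff: "loopless M \<Longrightarrow> rk M (ground M) = 0 \<longleftrightarrow> ground M = {}"
  by (metis rk_pos rk_empty order_refl neq0_conv)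

text \<open>Among the independent subsets of \<open>X\<close> containing \<open>I\<close>, take a
  maximal one. If it were smaller than a largest independent subset of \<open>X\<close>, exchange
  would enlarge it.\<close>

lemma indep_extend:
  assumes "I \<in> indep_sets M" "I \<subseteq> X"
  obtains B where "B \<in> indep_sets M" "I \<subseteq> B" "B \<subseteq> X" "card B = rk M X"
proof -
  have "I \<in> {I \<in> indep_sets M. I \<subseteq> X}" using assms by simp
  from finite_has_maximal2[OF finite_indep_subsets this]
  obtain B where B: "B \<in> indep_sets M" "B \<subseteq> X" "I \<subseteq> B"
    and max: "\<And>J. J \<in> indep_sets M \<Longrightarrow> J \<subseteq> X \<Longrightarrow> B \<subseteq> J \<Longrightarrow> B = J"
    by auto
  obtain J where J: "J \<in> indep_sets M" "J \<subseteq> X" "card J = rk M X"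
    by (rule rk_attained)
  have "\<not> card B < card J"
  proof
    assume "card B < card J"
    then obtain x where "x \<in> J - B" "insert x B \<in> indep_sets M"
      using matroidD(5) B(1) J(1) by blast
    with max[of "insert x B"] B(2) J(2) show False by blast
  qed
  with card_le_rk[OF B(1,2)] J(3) have "card B = rk M X" by simp
  with B that show ?thesis by blast
qed

text \<open>Maximality under inclusion and maximality in size agree by \<open>indep_extend\<close>.
  This turns the bases used in \<open>contraction\<close> into a condition on ranks.\<close>

lemma bases_of_iff:
  "B \<in> bases_of (indep_sets M) X \<longleftrightarrow> B \<in> indep_sets M \<and> B \<subseteq> X \<and> card B = rk M X"
proof
  assume B: "B \<in> bases_of (indep_sets M) X"
  then have "B \<in> indep_sets M" "B \<subseteq> X" by (auto simp: bases_of_def)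
  moreover from this obtain C where "C \<in> indep_sets M" "B \<subseteq> C" "C \<subseteq> X" "card C = rk M X"
    by (rule indep_extend)
  ultimately show "B \<in> indep_sets M \<and> B \<subseteq> X \<and> card B = rk M X"
    using B by (auto simp: bases_of_def)
next
  assume B: "B \<in> indep_sets M \<and> B \<subseteq> X \<and> card B = rk M X"
  have "I = B" if "I \<in> indep_sets M" "B \<subseteq> I" "I \<subseteq> X" for I
    using card_seteq[of I B] card_le_rk[of I M X] B that indep_finite by auto
  with B show "B \<in> bases_of (indep_sets M) X" by (auto simp: bases_of_def)
qed

text \<open>A local form of submodularity. If \<open>e\<close> raised the rank of \<open>Y\<close>,
  a basis \<open>I\<close> of \<open>X\<close>, extended first to \<open>Y\<close> and then to
  \<open>insert e Y\<close>, would acquire \<open>e\<close>; then \<open>insert e I\<close> would be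
  independent and too large for \<open>insert e X\<close>.\<close>

lemma rk_insert_eq_mono:
  assumes "X \<subseteq> Y" "rk M (insert e X) = rk M X"
  shows "rk M (insert e Y) = rk M Y"
proof (rule ccontr)
  assume "rk M (insert e Y) \<noteq> rk M Y"
  then have less: "rk M Y < rk M (insert e Y)"
    using rk_mono[OF subset_insertI, of M Y e] by simp
  obtain I where I: "I \<in> indep_sets M" "I \<subseteq> X" "card I = rk M X"
    by (rule rk_attained)
  obtain B where B: "B \<in> indep_sets M" "I \<subseteq> B" "B \<subseteq> Y" "card B = rk M Y"
    using indep_extend[of I M Y] I assms by auto
  obtain C where C: "C \<in> indep_sets M" "B \<subseteq> C" "C \<subseteq> insert e Y" "card C = rk M (insert e Y)"
    using indep_extend[of B M "insert e Y"] B by auto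
  have "\<not> C \<subseteq> Y" using card_le_rk[OF C(1), of Y] C(4) less by auto
  then have e: "e \<in> C" "e \<notin> Y" using C(3) by auto
  then have "insert e I \<in> indep_sets M"
    using matroidD(4)[OF C(1), of "insert e I"] B(2) C(2) by auto
  then have "card (insert e I) \<le> rk M (insert e X)"
    using I(2) by (intro card_le_rk) auto
  moreover have "card (insert e I) = Suc (card I)"
    using e I(1,2) assms(1) by (auto intro!: card_insert_disjoint indep_finite)
  ultimately show False using I(3) assms(2) by simp
qed

lemma rk_Un_eq:
  assumes "finite A" "\<And>e. e \<in> A \<Longrightarrow> rk M (insert e X) = rk M X"
  shows "rk M (X \<union> A) = rk M X"
  using assms
proof (induction A rule: finite_induct)
  case (insert e A)
  then have "rk M (insert e (X \<union> A)) = rk M (X \<union> A)"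
    by (intro rk_insert_eq_mono[OF Un_upper1]) simp
  with insert show ?case by simp
qed simp

section \<open>Closure operator and flats\<close>

lemma subset_cl: "X \<subseteq> ground M \<Longrightarrow> X \<subseteq> cl M X"
  by (auto simp: cl_def insert_absorb)

lemma cl_subset_ground: "cl M X \<subseteq> ground M"
  by (auto simp: cl_def)

lemma rk_cl:
  assumes "X \<subseteq> ground M"
  shows "rk M (cl M X) = rk M X"
proof -
  have "rk M (X \<union> cl M X) = rk M X"
    by (rule rk_Un_eq) (use finite_subset[OF cl_subset_ground finite_ground] in \<open>auto simp: cl_def\<close>)
  moreover have "X \<union> cl M X = cl M X" using subset_cl[OF assms] by blast
  ultimately show ?thesis by simp
qed

text \<open>Only idempotence needs an argument: since \<open>X\<close> and its closure have equal
  rank, an element that leaves the rank of the closure unchanged also leaves that of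
  \<open>X\<close> unchanged.\<close>

lemma cl_in_flats:
  assumes "X \<subseteq> ground M"
  shows "cl M X \<in> flats M"
proof -
  have "cl M (cl M X) \<subseteq> cl M X"
  proof
    fix e assume e: "e \<in> cl M (cl M X)"
    then have "rk M (insert e (cl M X)) = rk M X"
      using rk_cl[OF assms] by (simp add: cl_def)
    moreover have "rk M (insert e X) \<le> rk M (insert e (cl M X))"
      using subset_cl[OF assms] by (intro rk_mono) auto
    moreover have "rk M X \<le> rk M (insert e X)" by (intro rk_mono) auto
    ultimately show "e \<in> cl M X" using e by (simp add: cl_def)
  qed
  then show ?thesis
    using subset_cl[OF cl_subset_ground] cl_subset_ground by (fastforce simp: flats_def)
qed

text \<open>This lets the condition that a word lies in \<open>F\<close> be read as \<open>F\<close>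
  lying above a fixed flat, the form that Moebius inversion needs.\<close>

lemma cl_subset_flat_iff:
  assumes "F \<in> flats M" "X \<subseteq> ground M"
  shows "cl M X \<subseteq> F \<longleftrightarrow> X \<subseteq> F"
proof
  assume "X \<subseteq> F"
  then have "cl M X \<subseteq> cl M F"
    using rk_insert_eq_mono[of X F M] by (auto simp: cl_def)
  with assms show "cl M X \<subseteq> F" by (simp add: flats_def)
qed (use subset_cl[OF assms(2)] in blast)

lemma ground_in_flats: "ground M \<in> flats M"
  by (auto simp: flats_def cl_def insert_absorb)

lemma finite_flats [simp]: "finite (flats M)"
  by (rule finite_subset[of _ "Pow (ground M)"]) (auto simp: flats_def)


section \<open>Restriction and contraction\<close>

lemma indep_sets_restriction: "indep_sets (restriction M F) = {I \<in> indep_sets M. I \<subseteq> F}"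
  by transfer auto

lemma rk_restriction: "X \<subseteq> F \<Longrightarrow> rk (restriction M F) X = rk M X"
  unfolding rk_def indep_sets_restriction
  by (intro arg_cong[where f = Max] arg_cong[where f = "image card"]) auto

lemma loopless_restriction: "loopless M \<Longrightarrow> loopless (restriction M F)"
  by (auto simp: loopless_def indep_sets_restriction ground_restriction)

lemma ground_contraction: "ground (contraction M F) = ground M - F"
  by transfer auto

lemma indep_sets_contraction:
  "indep_sets (contraction M F) =
     {I. I \<inter> F = {} \<and> (\<exists>B\<in>bases_of (indep_sets M) F. I \<union> B \<in> indep_sets M)}"
  by transfer auto

text \<open>Independent sets of the contraction correspond to independent sets of \<open>M\<close>
  extending a basis of \<open>F\<close>. The additive form avoids truncated subtraction.\<close>

lemma rk_contraction:
  assumes "X \<inter> F = {}"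
  shows "rk (contraction M F) X + rk M F = rk M (X \<union> F)"
proof (rule antisym)
  obtain I where I: "I \<in> indep_sets (contraction M F)" "I \<subseteq> X" "card I = rk (contraction M F) X"
    by (rule rk_attained)
  then obtain B where B: "B \<subseteq> F" "card B = rk M F" "I \<union> B \<in> indep_sets M" "I \<inter> F = {}"
    by (auto simp: indep_sets_contraction bases_of_iff)
  have "card (I \<union> B) = card I + card B"
    by (rule card_Un_disjoint) (use B indep_finite[OF B(3)] in auto)
  moreover have "card (I \<union> B) \<le> rk M (X \<union> F)"
    by (rule card_le_rk) (use B I in auto)
  ultimately show "rk (contraction M F) X + rk M F \<le> rk M (X \<union> F)"
    using I B by simp
next
  obtain B where B: "B \<in> indep_sets M" "B \<subseteq> F" "card B = rk M F"
    by (rule rk_attained)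
  obtain C where C: "C \<in> indep_sets M" "B \<subseteq> C" "C \<subseteq> X \<union> F" "card C = rk M (X \<union> F)"
    using indep_extend[of B M "X \<union> F"] B by auto
  \<comment> \<open>\<open>B\<close> already has the largest size of an independent subset of
    \<open>F\<close>, so extending it to \<open>C\<close> adds nothing inside \<open>F\<close> and
    \<open>C - B\<close> lies in \<open>X\<close>.\<close>
  have "C \<inter> F \<in> indep_sets M" by (rule matroidD(4)[OF C(1)]) auto
  then have "C \<inter> F = B"
    using card_seteq[of "C \<inter> F" B] card_le_rk[of "C \<inter> F" M F] B C(2) indep_finite by auto
  moreover have "(C - B) \<union> B = C" using C(2) by blast
  moreover have "B \<in> bases_of (indep_sets M) F" using B by (simp add: bases_of_iff)
  ultimately have "C - B \<in> indep_sets (contraction M F)"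
    using C(1) unfolding indep_sets_contraction by (intro CollectI conjI bexI[of _ B]) auto
  moreover have "C - B \<subseteq> X" using \<open>C \<inter> F = B\<close> C(3) by blast
  ultimately have "card (C - B) \<le> rk (contraction M F) X" by (rule card_le_rk)
  moreover have "card C = card (C - B) + card B"
    using C(2) indep_finite[OF C(1)] card_mono[of C B]
    by (subst card_Diff_subset) (auto intro: finite_subset)
  ultimately show "rk M (X \<union> F) \<le> rk (contraction M F) X + rk M F"
    using B C by simp
qed

lemma cl_contraction:
  assumes "X \<inter> F = {}"
  shows "cl (contraction M F) X = cl M (X \<union> F) - F"
proof -
  have "rk (contraction M F) (insert e X) = rk (contraction M F) X \<longleftrightarrow>
        rk M (insert e (X \<union> F)) = rk M (X \<union> F)" if "e \<notin> F" for e
    using rk_contraction[of X F M] rk_contraction[of "insert e X" F M] assms that by auto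
  then show ?thesis by (auto simp: cl_def ground_contraction)
qed

text \<open>The closure of \<open>G - F\<close> in the contraction is \<open>cl M G - F\<close>. As
  \<open>F\<close> lies in both \<open>G\<close> and \<open>cl M G\<close>, removing it loses no
  information.\<close>

lemma Diff_in_flats_contraction_iff:
  assumes "F \<in> flats M" "F \<subseteq> G"
  shows "G - F \<in> flats (contraction M F) \<longleftrightarrow> G \<in> flats M"
proof -
  have F: "F \<subseteq> ground M" using assms by (simp add: flats_subset)
  have eq: "(G - F) \<union> F = G" using assms by blast
  have "F \<subseteq> cl M G" if "G \<subseteq> ground M" using subset_cl[OF that] assms by blast
  then show ?thesis
    using assms F cl_contraction[of "G - F" F M] unfolding flats_def eq ground_contraction
    by auto blast+
qed

lemma bij_betw_flats_contraction:
  assumes "F \<in> flats M"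
  shows "bij_betw (\<lambda>G. G - F) {G \<in> flats M. F \<subseteq> G} (flats (contraction M F))"
proof (rule bij_betwI[where g = "\<lambda>K. K \<union> F"])
  show "(\<lambda>K. K \<union> F) \<in> flats (contraction M F) \<rightarrow> {G \<in> flats M. F \<subseteq> G}"
  proof
    fix K assume K: "K \<in> flats (contraction M F)"
    then have "(K \<union> F) - F = K"
      using flats_subset[OF K] by (auto simp: ground_contraction)
    with K show "K \<union> F \<in> {G \<in> flats M. F \<subseteq> G}"
      using Diff_in_flats_contraction_iff[OF assms, of "K \<union> F"] by auto
  qed
qed (use Diff_in_flats_contraction_iff[OF assms] in
      \<open>auto dest!: flats_subset simp: ground_contraction\<close>)

text \<open>The recursion for \<open>moebius\<close> sees only the interval from \<open>F\<close> to
  \<open>G\<close>, which removal of \<open>F\<close> carries onto the interval from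
  \<open>{}\<close> to \<open>G - F\<close>. Induction on \<open>G\<close> matches the
  terms.\<close>

lemma moebius_contraction:
  assumes "F \<in> flats M" "G \<in> flats M" "F \<subseteq> G"
  shows "moebius (contraction M F) {} (G - F) = moebius M F G"
  using flats_finite[OF assms(2)] assms(2,3)
proof (induction G rule: finite_psubset_induct)
  case (psubset G)
  let ?N = "contraction M F"
  have flats: "{} \<in> flats ?N" "G - F \<in> flats ?N"
    using Diff_in_flats_contraction_iff[OF assms(1), of F]
      Diff_in_flats_contraction_iff[OF assms(1), of G] assms(1) psubset.prems by auto
  show ?case
  proof (cases "F = G")
    case True
    then show ?thesis using assms(1) flats by (simp add: moebius.simps)
  next
    case False
    have bij: "bij_betw (\<lambda>H. H - F) {H \<in> flats M. F \<subseteq> H \<and> H \<subset> G} {K \<in> flats ?N. K \<subset> G - F}"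
    proof (rule bij_betw_subset[OF bij_betw_flats_contraction[OF assms(1)]])
      show "(\<lambda>H. H - F) ` {H \<in> flats M. F \<subseteq> H \<and> H \<subset> G} = {K \<in> flats ?N. K \<subset> G - F}"
      proof (intro equalityI subsetI)
        fix K assume K: "K \<in> {K \<in> flats ?N. K \<subset> G - F}"
        then obtain H where H: "H \<in> flats M" "F \<subseteq> H" "K = H - F"
          using bij_betw_imp_surj_on[OF bij_betw_flats_contraction[OF assms(1)]] by blast
        with K show "K \<in> (\<lambda>H. H - F) ` {H \<in> flats M. F \<subseteq> H \<and> H \<subset> G}"
          using psubset.prems by blast
      qed (use Diff_in_flats_contraction_iff[OF assms(1)] psubset.prems in auto)
    qed auto
    have "moebius ?N {} (G - F) = - (\<Sum>K\<in>{K \<in> flats ?N. K \<subset> G - F}. moebius ?N {} K)"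
      using flats False psubset.prems by (subst moebius.simps) auto
    also have "\<dots> = - (\<Sum>H\<in>{H \<in> flats M. F \<subseteq> H \<and> H \<subset> G}. moebius ?N {} (H - F))"
      by (simp add: sum.reindex_bij_betw[OF bij, symmetric])
    also have "\<dots> = - (\<Sum>H\<in>{H \<in> flats M. F \<subseteq> H \<and> H \<subset> G}. moebius M F H)"
      using psubset.IH by (intro arg_cong[where f = uminus] sum.cong) auto
    also have "\<dots> = moebius M F G"
      using assms(1) False psubset.prems by (subst (2) moebius.simps) auto
    finally show ?thesis .
  qed
qed


section \<open>Moebius inversion\<close>

lemma sum_moebius_upper:
  assumes "F \<in> flats M" "G \<in> flats M" "F \<subseteq> G"
  shows "(\<Sum>H\<in>{H \<in> flats M. F \<subseteq> H \<and> H \<subseteq> G}. moebius M F H) = of_bool (F = G)"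
proof (cases "F = G")
  case True
  then have "{H \<in> flats M. F \<subseteq> H \<and> H \<subseteq> G} = {G}" using assms by auto
  then show ?thesis using assms True by (simp add: moebius.simps)
next
  case False
  have "{H \<in> flats M. F \<subseteq> H \<and> H \<subseteq> G} = insert G {H \<in> flats M. F \<subseteq> H \<and> H \<subset> G}"
    using assms by auto
  then show ?thesis using assms False by (simp add: moebius.simps[of M F G])
qed

text \<open>
  The recursion says that the Moebius function is a right inverse of the zeta function in the
  incidence algebra. If f denotes its product with the zeta function on the other side, then
  the sum of f G K over K in [G, H] is 1 for all G \<open>\<subseteq>\<close> H, which forces f to be the unit.
\<close>

lemma sum_moebius_lower:
  assumes "G \<in> flats M" "H \<in> flats M" "G \<subseteq> H"
  shows "(\<Sum>F\<in>{F \<in> flats M. G \<subseteq> F \<and> F \<subseteq> H}. moebius M F H) = of_bool (G = H)"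
  using flats_finite[OF assms(2)] assms(2,3)
proof (induction H rule: finite_psubset_induct)
  case (psubset H)
  define f where "f K = (\<Sum>F\<in>{F \<in> flats M. G \<subseteq> F \<and> F \<subseteq> K}. moebius M F K)" for K
  let ?I = "{K \<in> flats M. G \<subseteq> K \<and> K \<subseteq> H}"
  have "(\<Sum>K\<in>?I. f K) = (\<Sum>K\<in>?I. \<Sum>F\<in>?I. if F \<subseteq> K then moebius M F K else 0)"
    unfolding f_def
    by (rule sum.cong[OF refl], rule sum.mono_neutral_cong_left) auto
  also have "\<dots> = (\<Sum>F\<in>?I. \<Sum>K\<in>?I. if F \<subseteq> K then moebius M F K else 0)"
    by (rule sum.swap)
  also have "\<dots> = (\<Sum>F\<in>?I. \<Sum>K\<in>{K \<in> flats M. F \<subseteq> K \<and> K \<subseteq> H}. moebius M F K)"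
    by (rule sum.cong[OF refl], rule sum.mono_neutral_cong_right) auto
  also have "\<dots> = (\<Sum>F\<in>?I. of_bool (F = H))"
    using psubset.prems by (intro sum.cong refl sum_moebius_upper) auto
  also have "\<dots> = 1"
    using psubset.prems by (simp add: of_bool_def)
  finally have total: "(\<Sum>K\<in>?I. f K) = 1" .
  have "?I = insert H {K \<in> flats M. G \<subseteq> K \<and> K \<subset> H}"
    using psubset.prems by auto
  then have "f H + (\<Sum>K\<in>{K \<in> flats M. G \<subseteq> K \<and> K \<subset> H}. f K) = 1"
    using total by simp
  \<comment> \<open>By induction each \<open>f K\<close> below \<open>H\<close> is 1 at
    \<open>K = G\<close> and 0 elsewhere, so these terms already account for the total 1 unless
    \<open>G = H\<close>.\<close>
  moreover have "(\<Sum>K\<in>{K \<in> flats M. G \<subseteq> K \<and> K \<subset> H}. f K) =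
                 (\<Sum>K\<in>{K \<in> flats M. G \<subseteq> K \<and> K \<subset> H}. of_bool (G = K))"
    unfolding f_def using psubset.IH by (intro sum.cong refl) auto
  moreover have "\<dots> = of_bool (G \<noteq> H)"
    using assms(1) psubset.prems by (auto simp: of_bool_def psubset_eq)
  ultimately show ?case by (cases "G = H") (simp_all add: f_def)
qed

section \<open>Reduced characteristic polynomials at 1\<close>

lemma poly_div_root_eq_pderiv:
  fixes p :: "'a :: idom_divide poly"
  assumes "poly p a = 0"
  shows "poly (p div [:-a, 1:]) a = poly (pderiv p) a"
proof -
  obtain q where q: "p = [:-a, 1:] * q"
    using assms by (auto simp: poly_eq_0_iff_dvd)
  then have "p div [:-a, 1:] = q" by (metis nonzero_mult_div_cancel_left pCons_eq_0_iff one_neq_zero)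
  \<comment> \<open>The product rule gives \<open>q\<close> plus a multiple of x - a, and the latter
    vanishes at \<open>a\<close>.\<close>
  moreover have "poly (pderiv p) a = poly q a"
    unfolding q pderiv_mult by (simp add: pderiv_pCons)
  ultimately show ?thesis by simp
qed

text \<open>For \<open>F \<noteq> ground M\<close> the Moebius values sum to 0, so 1 is a root and
  the quotient takes the value of the derivative there, to which each monomial contributes its
  exponent.\<close>

lemma poly_red_char_poly_contraction:
  assumes "F \<in> flats M" "F \<noteq> ground M"
  shows "poly (red_char_poly (contraction M F)) 1 =
         (\<Sum>G\<in>{G \<in> flats M. F \<subseteq> G}. moebius M F G * int (rk M (ground M) - rk M G))"
proof -
  let ?N = "contraction M F"
  have F: "F \<subseteq> ground M" using assms by (simp add: flats_subset)
  have "rk ?N (ground ?N) - rk ?N (G - F) = rk M (ground M) - rk M G" if "F \<subseteq> G" for G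
  proof -
    have "(ground M - F) \<inter> F = {}" "(G - F) \<inter> F = {}" by auto
    from this[THEN rk_contraction, of M] that F show ?thesis
      by (simp add: ground_contraction Un_absorb2)
  qed
  then have chi: "char_poly ?N = (\<Sum>G\<in>{G \<in> flats M. F \<subseteq> G}.
      monom (moebius M F G) (rk M (ground M) - rk M G))"
    unfolding char_poly_def
    by (subst sum.reindex_bij_betw[OF bij_betw_flats_contraction[OF assms(1)], symmetric])
       (intro sum.cong refl, simp add: moebius_contraction[OF assms(1)])
  have "{G \<in> flats M. F \<subseteq> G} = {G \<in> flats M. F \<subseteq> G \<and> G \<subseteq> ground M}"
    using flats_subset by blast
  then have "poly (char_poly ?N) 1 = 0"
    using sum_moebius_upper[OF assms(1) ground_in_flats F] assms(2)
    by (simp add: chi poly_sum poly_monom)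
  then have "poly (red_char_poly ?N) 1 = poly (pderiv (char_poly ?N)) 1"
    unfolding red_char_poly_def by (rule poly_div_root_eq_pderiv)
  also have "\<dots> = (\<Sum>G\<in>{G \<in> flats M. F \<subseteq> G}. moebius M F G * int (rk M (ground M) - rk M G))"
    by (simp add: chi higher_pderiv_sum[of 1, simplified] poly_sum pderiv_monom poly_monom mult.commute)
  finally show ?thesis .
qed

text \<open>After exchanging the sums, the inner one runs over \<open>moebius M F H\<close> for
  \<open>F\<close> between \<open>G\<close> and \<open>H\<close>, so only \<open>H = G\<close>
  survives.\<close>

lemma sum_red_char_poly_contraction:
  assumes "G \<in> flats M"
  shows "(\<Sum>F\<in>{F \<in> flats M - {ground M}. G \<subseteq> F}. poly (red_char_poly (contraction M F)) 1) =
         int (rk M (ground M) - rk M G)"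
proof -
  let ?d = "\<lambda>H. int (rk M (ground M) - rk M H)"
  let ?U = "{F \<in> flats M. G \<subseteq> F}"
  have "(\<Sum>F\<in>{F \<in> flats M - {ground M}. G \<subseteq> F}. poly (red_char_poly (contraction M F)) 1) =
        (\<Sum>F\<in>?U. \<Sum>H\<in>{H \<in> flats M. F \<subseteq> H}. moebius M F H * ?d H)"
  proof (rule sum.mono_neutral_cong_left)
    \<comment> \<open>The term \<open>F = ground M\<close> may be included: the only flat above it
      is itself, where \<open>?d\<close> is 0.\<close>
    have "{H \<in> flats M. ground M \<subseteq> H} = {ground M}"
      using flats_subset ground_in_flats by blast
    then show "\<forall>F\<in>?U - {F \<in> flats M - {ground M}. G \<subseteq> F}.
        (\<Sum>H\<in>{H \<in> flats M. F \<subseteq> H}. moebius M F H * ?d H) = 0" by auto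
  qed (auto simp: poly_red_char_poly_contraction)
  also have "\<dots> = (\<Sum>F\<in>?U. \<Sum>H\<in>?U. if F \<subseteq> H then moebius M F H * ?d H else 0)"
    by (rule sum.cong[OF refl], rule sum.mono_neutral_cong_left) auto
  also have "\<dots> = (\<Sum>H\<in>?U. \<Sum>F\<in>?U. if F \<subseteq> H then moebius M F H * ?d H else 0)"
    by (rule sum.swap)
  also have "\<dots> = (\<Sum>H\<in>?U. \<Sum>F\<in>{F \<in> flats M. G \<subseteq> F \<and> F \<subseteq> H}. moebius M F H * ?d H)"
    by (rule sum.cong[OF refl], rule sum.mono_neutral_cong_right) auto
  also have "\<dots> = (\<Sum>H\<in>?U. of_bool (G = H) * ?d H)"
    using sum_moebius_lower[OF assms]
    by (intro sum.cong refl) (simp flip: sum_distrib_right)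
  also have "\<dots> = ?d G"
    using assms by (simp add: of_bool_def if_distrib[of "\<lambda>x. x * _"] cong: if_cong)
  finally show ?thesis .
qed


section \<open>Expansion of rational functions\<close>

lemma fps_to_fls_of_poly_eq_0_iff [simp]:
  fixes q :: "'a :: field poly"
  shows "fps_to_fls (fps_of_poly q) = 0 \<longleftrightarrow> q = 0"
  using fps_of_poly_eq_iff[of q 0] by simp

lemma fls_of_fract_to_fract: "fls_of_fract (to_fract p) = fps_to_fls (fps_of_poly p)"
  by (simp add: to_fract_def fls_of_fract_Fract)

text \<open>Together with multiplicativity, this makes the expansion a ring homomorphism, which
  carries the recursion for \<open>Z_top\<close> over to Laurent series.\<close>

lemma fls_of_fract_add: "fls_of_fract (x + y) = fls_of_fract x + fls_of_fract y"
  by (cases x; cases y)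
     (simp add: fls_of_fract_Fract fps_of_poly_add fps_of_poly_mult fls_times_fps_to_fls
        add_frac_eq)

lemma fls_of_fract_mult: "fls_of_fract (x * y) = fls_of_fract x * fls_of_fract y"
  by (cases x; cases y)
     (simp add: fls_of_fract_Fract fps_of_poly_mult fls_times_fps_to_fls)

lemma to_fract_of_int: "to_fract (of_int k) = of_int k"
  by (induction k rule: int_induct[of _ 0]) simp_all

lemma fps_to_fls_sum: "fps_to_fls (\<Sum>x\<in>A. f x) = (\<Sum>x\<in>A. fps_to_fls (f x))"
  by (induction A rule: infinite_finite_induct) simp_all

lemma fls_of_fract_of_int: "fls_of_fract (of_int k) = (of_int k :: 'a :: field fls)"
proof -
  have "fls_of_fract (of_int k :: 'a poly fract) = fps_to_fls (fps_of_poly (of_int k))"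
    using fls_of_fract_to_fract[of "of_int k"] unfolding to_fract_of_int .
  then show ?thesis by (simp only: of_int_poly fps_of_poly_const fps_of_int fps_to_fls_of_int)
qed

lemma fls_of_fract_0 [simp]: "fls_of_fract 0 = 0"
  using fls_of_fract_of_int[of 0] by simp

lemma fls_of_fract_1 [simp]: "fls_of_fract 1 = 1"
  using fls_of_fract_of_int[of 1] by simp

lemma fls_of_fract_sum: "fls_of_fract (\<Sum>x\<in>A. f x) = (\<Sum>x\<in>A. fls_of_fract (f x))"
  by (induction A rule: infinite_finite_induct) (simp_all add: fls_of_fract_add)


section \<open>Weighted sums over words\<close>

text \<open>The index starts at 1, so only nonempty prefixes enter; for words over the ground set of
  a loopless matroid their ranks are positive and no division by zero occurs.\<close>

definition word_weight :: "'a matroid \<Rightarrow> 'a list \<Rightarrow> rat" where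
  "word_weight M es = (\<Prod>j=1..length es. 1 / of_nat (rk M (set (take j es))))"

definition words_series :: "'a matroid \<Rightarrow> rat fps" where
  "words_series M = Abs_fps (\<lambda>m. (-1) ^ m * (\<Sum>es\<in>words (ground M) m. word_weight M es))"

lemma finite_words [simp]: "finite E \<Longrightarrow> finite (words E m)"
  using finite_lists_length_eq[of E m] by (simp add: words_def conj_commute)

lemma words_0 [simp]: "words E 0 = {[]}"
  by (auto simp: words_def)

lemma words_empty_Suc [simp]: "words {} (Suc m) = {}"
  by (auto simp: words_def)

lemma word_weight_restriction:
  "set es \<subseteq> F \<Longrightarrow> word_weight (restriction M F) es = word_weight M es"
  unfolding word_weight_def
  by (intro prod.cong refl) (metis rk_restriction set_take_subset subset_trans)

lemma word_weight_snoc: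
  "word_weight M (es @ [e]) = word_weight M es / of_nat (rk M (set (es @ [e])))"
  by (simp add: word_weight_def atLeastAtMostSuc_conv)

text \<open>The last letter is split off, not the first, because the weights are built from
  prefixes.\<close>

lemma words_Suc: "words E (Suc m) = (\<lambda>(es, e). es @ [e]) ` (words E m \<times> E)"
proof (intro equalityI subsetI)
  fix es assume "es \<in> words E (Suc m)"
  then have "es = butlast es @ [last es]" "butlast es \<in> words E m" "last es \<in> E"
    by (auto simp: words_def dest: in_set_butlastD intro!: subsetD[OF _ last_in_set])
       (metis append_butlast_last_id length_0_conv nat.simps(3))
  then show "es \<in> (\<lambda>(es, e). es @ [e]) ` (words E m \<times> E)"
    by (intro image_eqI[of _ _ "(butlast es, last es)"]) auto
qed (auto simp: words_def)

text \<open>The rank of the whole word cancels the last factor of its weight. The last letter is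
  then free, which yields the factor \<open>card (ground M)\<close>.\<close>

lemma sum_rk_word_weight_Suc:
  assumes "loopless M"
  shows "(\<Sum>es\<in>words (ground M) (Suc m). of_nat (rk M (set es)) * word_weight M es) =
         of_nat (card (ground M)) * (\<Sum>es\<in>words (ground M) m. word_weight M es)"
proof -
  let ?E = "ground M"
  have inj: "inj_on (\<lambda>(es, e). es @ [e]) (words ?E m \<times> ?E)"
    by (auto simp: inj_on_def)
  \<comment> \<open>The cancelled rank is nonzero, since the word is nonempty and \<open>M\<close>
    is loopless.\<close>
  have "of_nat (rk M (set (es @ [e]))) * word_weight M (es @ [e]) = word_weight M es"
    if "es \<in> words ?E m" "e \<in> ?E" for es e
    unfolding word_weight_snoc
    using rk_pos[OF assms, of "set (es @ [e])"] that by (auto simp: words_def)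
  then have "(\<Sum>es\<in>words ?E (Suc m). of_nat (rk M (set es)) * word_weight M es) =
             (\<Sum>(es, e)\<in>words ?E m \<times> ?E. word_weight M es)"
    unfolding words_Suc sum.reindex[OF inj] by (intro sum.cong) (auto simp del: set_append)
  also have "\<dots> = of_nat (card ?E) * (\<Sum>es\<in>words ?E m. word_weight M es)"
    by (simp add: sum.cartesian_product[symmetric] sum_distrib_left)
  finally show ?thesis .
qed

text \<open>The common shape of both recursions: \<open>c\<close> will be the values of the reduced
  characteristic polynomials for Z, and \<open>moebius M F (ground M)\<close> for Y.\<close>

lemma sum_flats_words_series_nth:
  fixes c :: "'a set \<Rightarrow> int"
  assumes "\<F> \<subseteq> flats M"
  shows "(\<Sum>F\<in>\<F>. words_series (restriction M F) * of_int (c F)) $ m =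
         (-1) ^ m * (\<Sum>es\<in>words (ground M) m.
           word_weight M es * of_int (\<Sum>F\<in>{F \<in> \<F>. cl M (set es) \<subseteq> F}. c F))"
proof -
  let ?W = "words (ground M) m"
  have fin: "finite \<F>" using assms finite_flats finite_subset by blast
  have ground: "ground (restriction M F) = F" if "F \<in> \<F>" for F
    using that assms flats_subset by (auto simp: ground_restriction)
  have "(\<Sum>F\<in>\<F>. words_series (restriction M F) * of_int (c F)) $ m =
        (\<Sum>F\<in>\<F>. (-1) ^ m * (\<Sum>es\<in>words F m. word_weight M es) * of_int (c F))"
    unfolding fps_sum_nth
  proof (intro sum.cong refl)
    fix F assume "F \<in> \<F>"
    have "(\<Sum>es\<in>words F m. word_weight (restriction M F) es) = (\<Sum>es\<in>words F m. word_weight M es)"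
      by (intro sum.cong refl word_weight_restriction) (simp add: words_def)
    then show "(words_series (restriction M F) * of_int (c F)) $ m =
          (-1) ^ m * (\<Sum>es\<in>words F m. word_weight M es) * of_int (c F)"
      by (simp add: words_series_def ground[OF \<open>F \<in> \<F>\<close>] fps_of_int[symmetric])
  qed
  also have "\<dots> = (-1) ^ m * (\<Sum>F\<in>\<F>. \<Sum>es\<in>words F m. word_weight M es * of_int (c F))"
    by (simp add: sum_distrib_left sum_distrib_right mult.assoc)
  also have "(\<Sum>F\<in>\<F>. \<Sum>es\<in>words F m. word_weight M es * of_int (c F)) =
             (\<Sum>F\<in>\<F>. \<Sum>es\<in>?W. if cl M (set es) \<subseteq> F then word_weight M es * of_int (c F) else 0)"
  \<comment> \<open>A word over the ground set is a word over the flat \<open>F\<close> exactly when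
    its closure lies in \<open>F\<close>; padding with zeros gives all flats the same index set of
    words.\<close>
  proof (rule sum.cong[OF refl], rule sum.mono_neutral_cong_left)
    fix F assume F: "F \<in> \<F>"
    show "words F m \<subseteq> ?W"
      using flats_subset[of F M] F assms by (auto simp: words_def)
    show "\<forall>es\<in>?W - words F m.
        (if cl M (set es) \<subseteq> F then word_weight M es * of_int (c F) else 0) = 0"
      using F assms cl_subset_flat_iff by (fastforce simp: words_def)
    fix es assume "es \<in> words F m"
    then have "cl M (set es) \<subseteq> F"
      using flats_subset[of F M] F assms by (subst cl_subset_flat_iff) (auto simp: words_def)
    then show "word_weight M es * of_int (c F) =
        (if cl M (set es) \<subseteq> F then word_weight M es * of_int (c F) else 0)" by simp
  qed simp
  also have "\<dots> = (\<Sum>es\<in>?W. \<Sum>F\<in>\<F>.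
      if cl M (set es) \<subseteq> F then word_weight M es * of_int (c F) else 0)"
    by (rule sum.swap)
  also have "\<dots> = (\<Sum>es\<in>?W. word_weight M es * of_int (\<Sum>F\<in>{F \<in> \<F>. cl M (set es) \<subseteq> F}. c F))"
    using fin by (simp add: sum_distrib_left sum.inter_filter[symmetric])
  finally show ?thesis .
qed

section \<open>Expansions of Z and Y\<close>

lemma words_series_recursion:
  assumes "loopless M"
  shows "words_series M *
           fps_of_poly [:of_nat (rk M (ground M)), of_nat (card (ground M)):] =
         (\<Sum>F\<in>flats M - {ground M}. words_series (restriction M F) *
            of_int (poly (red_char_poly (contraction M F)) 1))"
    (is "?L = ?R")
proof (rule fps_ext)
  fix m
  let ?E = "ground M"
  let ?r = "of_nat (rk M ?E) :: rat" and ?n = "of_nat (card ?E) :: rat"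
  let ?W = "\<lambda>m. \<Sum>es\<in>words ?E m. word_weight M es"
  have "of_int (\<Sum>F\<in>{F \<in> flats M - {?E}. cl M (set es) \<subseteq> F}.
      poly (red_char_poly (contraction M F)) 1) = ?r - of_nat (rk M (set es))"
    if "es \<in> words ?E m" for es
  proof -
    have "set es \<subseteq> ?E" using that by (simp add: words_def)
    \<comment> \<open>The closure has the rank of the word itself, and monotonicity of the rank
      makes the subtraction of naturals a genuine difference.\<close>
    then show ?thesis
      using rk_mono[of "set es" ?E M]
      unfolding sum_red_char_poly_contraction[OF cl_in_flats[OF \<open>set es \<subseteq> ?E\<close>]]
      by (simp add: rk_cl of_nat_diff)
  qed
  then have "?R $ m = (-1) ^ m * (\<Sum>es\<in>words ?E m.
      word_weight M es * (?r - of_nat (rk M (set es))))"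
    by (subst sum_flats_words_series_nth) (auto simp del: of_int_sum)
  also have "\<dots> = (-1) ^ m * (?r * ?W m -
      (\<Sum>es\<in>words ?E m. of_nat (rk M (set es)) * word_weight M es))"
    by (simp add: algebra_simps sum_subtractf sum_distrib_left)
  also have "\<dots> = ?L $ m"
  proof -
    have lin: "fps_of_poly [:?r, ?n:] = fps_const ?r + fps_const ?n * fps_X"
      by (simp add: fps_of_poly_pCons)
    \<comment> \<open>In degree 0 only the empty word occurs, with rank 0 and weight 1, so both
      sides are \<open>?r\<close>. In degree \<open>Suc k\<close> the minus sign turns
      \<open>(-1) ^ Suc k\<close> into \<open>(-1) ^ k\<close>, matching the shift by
      \<open>fps_X\<close>.\<close>
    show ?thesis
    proof (cases m)
      case 0
      then show ?thesis by (simp add: lin words_series_def)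
    next
      case (Suc k)
      have "?L = fps_const ?r * words_series M + fps_const ?n * (words_series M * fps_X)"
        unfolding lin by (simp add: algebra_simps)
      then show ?thesis
        unfolding Suc by (simp add: sum_rk_word_weight_Suc[OF assms] words_series_def right_diff_distrib)
    qed
  qed
  finally show "?L $ m = ?R $ m" by simp
qed

text \<open>Both sides satisfy the same recursion with the denominator cleared. Proper flats have
  smaller ground sets, so induction identifies the right-hand sides, and the nonzero linear factor
  cancels.\<close>

lemma fls_of_fract_Z_top:
  assumes "loopless M"
  shows "fls_of_fract (Z_top M) = fps_to_fls (words_series M)"
  using assms
proof (induction "card (ground M)" arbitrary: M rule: less_induct)
  case less
  let ?E = "ground M"
  let ?q = "[:of_nat (rk M ?E), of_nat (card ?E):] :: rat poly"
  show ?case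
  proof (cases "rk M ?E = 0")
    case True
    then have "?E = {}" using rk_ground_eq_0_iff less.prems by blast
    \<comment> \<open>Over the empty ground set only the empty word exists, and its weight is the
      empty product.\<close>
    have "words_series M $ m = 1 $ m" for m
      by (cases m) (simp_all add: words_series_def word_weight_def \<open>?E = {}\<close>)
    then have "words_series M = 1" by (rule fps_ext)
    with True show ?thesis by (simp add: Z_top.simps)
  next
    case False
    let ?c = "\<lambda>F. poly (red_char_poly (contraction M F)) 1"
    have q: "?q \<noteq> 0" using False by simp
    have "Z_top M * to_fract ?q =
        (\<Sum>F\<in>flats M - {?E}. Z_top (restriction M F) * of_int (?c F))"
      using False q by (subst Z_top.simps) simp
    from arg_cong[OF this, of fls_of_fract]
    have "fls_of_fract (Z_top M) * fps_to_fls (fps_of_poly ?q) =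
        (\<Sum>F\<in>flats M - {?E}. fls_of_fract (Z_top (restriction M F)) * of_int (?c F))"
      by (simp only: fls_of_fract_of_int fls_of_fract_mult fls_of_fract_sum fls_of_fract_to_fract)
    also have "\<dots> = (\<Sum>F\<in>flats M - {?E}.
        fps_to_fls (words_series (restriction M F)) * of_int (?c F))"
    proof (intro sum.cong refl)
      fix F assume "F \<in> flats M - {?E}"
      then have "card (ground (restriction M F)) < card ?E"
        using flats_subset[of F M] by (auto simp: ground_restriction intro!: psubset_card_mono)
      then show "fls_of_fract (Z_top (restriction M F)) * of_int (?c F) =
          fps_to_fls (words_series (restriction M F)) * of_int (?c F)"
        using less by (simp add: loopless_restriction)
    qed
    also have "\<dots> = fps_to_fls (words_series M) * fps_to_fls (fps_of_poly ?q)"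
      unfolding fls_times_fps_to_fls[symmetric] words_series_recursion[OF less.prems]
      by (simp add: fps_to_fls_sum fls_times_fps_to_fls)
    finally show ?thesis using False by simp
  qed
qed

lemma fls_of_fract_Y_top:
  assumes "loopless M"
  shows "fls_of_fract (Y_top M) = fps_to_fls (Abs_fps (\<lambda>m. (-1) ^ m *
           (\<Sum>es\<in>{es \<in> words (ground M) m. cl M (set es) = ground M}. word_weight M es)))"
    (is "_ = fps_to_fls ?S")
proof (cases "rk M (ground M) = 0")
  case True
  then have E: "ground M = {}" using rk_ground_eq_0_iff assms by blast
  \<comment> \<open>In rank 0 the empty word is spanning and supplies the constant term 1.\<close>
  then have "cl M {} = {}" by (simp add: cl_def)
  then have "{es \<in> words (ground M) m. cl M (set es) = ground M} = words {} m" for m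
    by (auto simp: E words_def)
  then have "?S $ m = 1 $ m" for m
    by (cases m) (simp_all add: word_weight_def)
  then have "?S = 1" by (rule fps_ext)
  with True show ?thesis by (simp add: Y_top_def)
next
  case False
  let ?E = "ground M"
  have "fls_of_fract (Y_top M) =
      fps_to_fls (\<Sum>F\<in>flats M. words_series (restriction M F) * of_int (moebius M F ?E))"
    using False
    by (simp add: Y_top_def fls_of_fract_sum fls_of_fract_mult fls_of_fract_of_int
          fls_of_fract_Z_top loopless_restriction assms fps_to_fls_sum fls_times_fps_to_fls)
  also have "(\<Sum>F\<in>flats M. words_series (restriction M F) * of_int (moebius M F ?E)) = ?S"
  proof (rule fps_ext)
    fix m
    have "(\<Sum>F\<in>{F \<in> flats M. cl M (set es) \<subseteq> F}. moebius M F ?E) = of_bool (cl M (set es) = ?E)"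
      if "es \<in> words ?E m" for es
    proof -
      \<comment> \<open>All flats lie in \<open>?E\<close>, so the index set is a closed interval as
        in \<open>sum_moebius_lower\<close>.\<close>
      have "{F \<in> flats M. cl M (set es) \<subseteq> F} = {F \<in> flats M. cl M (set es) \<subseteq> F \<and> F \<subseteq> ?E}"
        using flats_subset by blast
      with that show ?thesis
        by (simp add: sum_moebius_lower[OF cl_in_flats ground_in_flats cl_subset_ground] words_def)
    qed
    then have "(\<Sum>es\<in>words ?E m.
          word_weight M es * of_int (\<Sum>F\<in>{F \<in> flats M. cl M (set es) \<subseteq> F}. moebius M F ?E)) =
        (\<Sum>es\<in>words ?E m. if cl M (set es) = ?E then word_weight M es else 0)"
      by (intro sum.cong refl) (auto simp del: of_int_sum)
    then show "(\<Sum>F\<in>flats M. words_series (restriction M F) * of_int (moebius M F ?E)) $ m = ?S $ m"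
      by (simp add: sum_flats_words_series_nth sum.inter_filter del: of_int_sum)
  qed
  finally show ?thesis .
qed

theorem mainTheorem1:
  fixes M :: "'a matroid"
  assumes "loopless M"
  shows "fls_of_fract (Z_top M) =
           fps_to_fls (Abs_fps (\<lambda>m. (-1) ^ m *
             (\<Sum>es\<in>words (ground M) m.
                \<Prod>j=1..m. 1 / of_nat (rk M (set (take j es)))))) \<and>
         fls_of_fract (Y_top M) =
           fps_to_fls (Abs_fps (\<lambda>m. (-1) ^ m *
             (\<Sum>es\<in>{es \<in> words (ground M) m. cl M (set es) = ground M}.
                \<Prod>j=1..m. 1 / of_nat (rk M (set (take j es))))))"
proof -
  have "(\<Prod>j=1..m. 1 / of_nat (rk M (set (take j es)))) = word_weight M es"
    if "es \<in> words (ground M) m" for es m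
    using that by (simp add: word_weight_def words_def)
  then show ?thesis
    unfolding fls_of_fract_Z_top[OF assms] fls_of_fract_Y_top[OF assms] words_series_def
    by (auto intro!: arg_cong[where f = fps_to_fls] arg_cong[where f = Abs_fps] sum.cong)
qed

end
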